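(* Let $\hat g\in\{A_{2n-1}^{(2)},B_n^{(1)},D_n^{(1)}\}$. Define the $d\times d$ matrices $$Z^{(r)}=\begin{pmatrix}0&0&1\\ 0&\mathbb I_{(d-2)\times(d-2)}&0\\ 1&0&0\end{pmatrix},\qquad Y(u)=\begin{pmatrix}0&0&e^{-u}\\ 0&\mathbb I_{(d-2)\times(d-2)}&0\\ e^u&0&0\end{pmatrix}.$$ Then the R-matrix obeys $$Z^{(r)}_1R_{12}(u)Z_1^{(r)}=Y_2^t(u)R_{12}(u)Y_2^t(u),\qquad Z^{(r)}_2R_{12}(u)Z_2^{(r)}=Y_1(u)R_{12}(u)Y_1(u).$$ Furthermore, for $1\le p\le n$ the K-matrices obey $$Y(u)K^R(u,p)Y^t(u)=K^R(u,p),\qquad Y^t(u)K^L(u,p)Y(u)=K^L(u,p).$$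
   Context: **R-matrix.** Fix $n\ge1$, $\eta\in\mathbb C$ and a type $\hat g\in\{A_{2n-1}^{(2)},B_n^{(1)},D_n^{(1)}\}$. Set $d=2n+1$ for $B_n^{(1)}$ and $d=2n$ for $A_{2n-1}^{(2)},D_n^{(1)}$; $\mathcal V=\mathbb C^d$; $e_{ij}$ the elementary $d\times d$ matrices. Let $\kappa=2n,\ 2n-1,\ 2n-2$ for $A_{2n-1}^{(2)},B_n^{(1)},D_n^{(1)}$ respectively. Let $h=\cosh$, $\sigma=-1$ for $A_{2n-1}^{(2)}$ and $h=\sinh$, $\sigma=+1$ for $B_n^{(1)},D_n^{(1)}$. Put $\alpha'=d+1-\alpha$. For $A_{2n-1}^{(2)}$: $\epsilon_\alpha=1$, $\bar\alpha=\alpha-\frac12$ if $\alpha\le n$; $\epsilon_\alpha=-1$, $\bar\alpha=\alpha+\frac12$ if $\alpha\ge n+1$. For $B_n^{(1)},D_n^{(1)}$: $\epsilon_\alpha=1$ and $\bar\alpha=\alpha+\frac12,\ \alpha,\ \alpha-\frac12$ according as $\alpha<\frac{d+1}2$, $\alpha=\frac{d+1}2$, $\alpha>\frac{d+1}2$. Let $$c(u)=2\sinh(\tfrac u2-2\eta)h(\tfrac u2-\kappa\eta),\quad b(u)=2\sinh(\tfrac u2)h(\tfrac u2-\kappa\eta),\quad e(u)=-2e^{-u/2}\sinh(2\eta)h(\tfrac u2-\kappa\eta),\quad \bar e(u)=e^ue(u),$$ and $a_{\alpha\beta}(u)$ equal to: $2\sinh(\frac u2)h(\frac u2-(\kappa-2)\eta)$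 if $\alpha=\beta\ne\alpha'$; $b(u)+2\sinh(2\eta)\sinh((2n-1)\eta)$ if $\alpha=\beta=\alpha'$ (only for $B_n^{(1)}$); $2\sinh(2\eta)e^{-u/2}[\sigma\epsilon_\alpha\epsilon_\beta e^{(\kappa+2(\bar\alpha-\bar\beta))\eta}\sinh(\frac u2)-\delta_{\alpha\beta'}h(\frac u2-\kappa\eta)]$ if $\alpha<\beta$; $2\sinh(2\eta)e^{u/2}[\epsilon_\alpha\epsilon_\beta e^{(-\kappa+2(\bar\alpha-\bar\beta))\eta}\sinh(\frac u2)-\delta_{\alpha\beta'}h(\frac u2-\kappa\eta)]$ if $\alpha>\beta$. Then, on $\mathcal V\otimes\mathcal V$, $$R_{12}(u)=R(u)=c(u)\sum_{\alpha\ne\alpha'}e_{\alpha\alpha}\otimes e_{\alpha\alpha}+b(u)\sum_{\alpha\neq\beta,\beta'}e_{\alpha\alpha}\otimes e_{\beta\beta}+\Big(e(u)\sum_{\alpha<\beta,\alpha\ne\beta'}+\bar e(u)\sum_{\alpha>\beta,\alpha\ne\beta'}\Big)e_{\alpha\beta}\otimes e_{\beta\alpha}+\sum_{\alpha,\beta}a_{\alpha\beta}(u)e_{\alpha\beta}\otimes e_{\alpha'\beta'}.$$ For a $d\times d$ matrix $X$, $X_1=X\otimes\mathbb I$, $X_2=\mathbb I\otimes X$; $t$ denotes transpose. **K-matrices.** $\rho=-2\kappa\eta-i\pi$ for $A_{2n-1}^{(2)}$, $\rho=-2\kappa\eta$ for $B_n^{(1)},D_n^{(1)}$. Fix $\gamma_0\in\{1,-1\}$;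 $\gamma=\gamma_0e^{(4p-2)\eta+\rho/2}$. $K^R(u,p)$ is diagonal with first $p$ entries $e^{-u}$, middle $d-2p$ entries $\frac{\gamma e^u+1}{\gamma+e^u}$, last $p$ entries $e^u$. $M=\varsigma\sum_\alpha e^{4(\frac{d+1}2-\bar\alpha)\eta}e_{\alpha\alpha}$ with $\varsigma=-1$ for $A_{2n-1}^{(2)}$, $\varsigma=1$ for $B_n^{(1)},D_n^{(1)}$; $K^L(u,p)=K^R(-u-\rho,p)M$. Identities in $u$ are understood as identities of meromorphic functions. *)

theory Defs
  imports Complex_Main "Jordan_Normal_Form.Matrix"
begin

text \<open>
  Matrices are Jordan_Normal_Form matrices, whose entries are addressed by row and column
  numbers counted from 0. The labels \<open>\<alpha>\<close>, \<open>\<beta>\<close> of the basis of \<open>\<V> = \<complex>\<^sup>d\<close> run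
  through \<open>{1..d}\<close>; the two numberings meet only in \<open>elem_mat\<close> and \<open>M_mat\<close>.
\<close>

definition elem_mat :: "nat \<Rightarrow> nat \<Rightarrow> nat \<Rightarrow> complex mat" where
  "elem_mat d \<alpha> \<beta> = mat d d (\<lambda>(i, j). if i + 1 = \<alpha> \<and> j + 1 = \<beta> then 1 else 0)"

text \<open>
  Kronecker product: the basis vector \<open>v\<^sub>i \<otimes> v\<^sub>j\<close> of \<open>\<V> \<otimes> \<V>\<close> has position \<open>i * d + j\<close>.
\<close>

definition kron :: "complex mat \<Rightarrow> complex mat \<Rightarrow> complex mat" where
  "kron A B = mat (dim_row A * dim_row B) (dim_col A * dim_col B)
     (\<lambda>(i, j). A $$ (i div dim_row B, j div dim_col B) * B $$ (i mod dim_row B, j mod dim_col B))"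

definition on_first :: "nat \<Rightarrow> complex mat \<Rightarrow> complex mat" where
  "on_first d X = kron X (1\<^sub>m d)"

definition on_second :: "nat \<Rightarrow> complex mat \<Rightarrow> complex mat" where
  "on_second d X = kron (1\<^sub>m d) X"

text \<open>
  Finite sums of square matrices, the analogue of \<open>finsum_vec\<close>. (The type of matrices of all
  sizes is not a \<open>comm_monoid_add\<close>, so \<open>sum\<close> is not available.)
\<close>

definition finsum_mat :: "nat \<Rightarrow> ('i \<Rightarrow> complex mat) \<Rightarrow> 'i set \<Rightarrow> complex mat" where
  "finsum_mat N = finprod (monoid_mat TYPE(complex) N N)"

lemma kron_carrier:
  assumes "A \<in> carrier_mat d d" "B \<in> carrier_mat d d"
  shows "kron A B \<in> carrier_mat (d * d) (d * d)"
  using assms unfolding kron_def by auto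

lemma finsum_mat_carrier:
  assumes "f \<in> F \<rightarrow> carrier_mat N N"
  shows "finsum_mat N f F \<in> carrier_mat N N"
  using comm_monoid.finprod_closed[OF comm_monoid_mat[where 'a = complex and nr = N and nc = N], of f F] assms
  by (simp add: finsum_mat_def monoid_mat_def)

lemma index_finsum_mat:
  assumes "finite F" "f \<in> F \<rightarrow> carrier_mat N N" "i < N" "j < N"
  shows "finsum_mat N f F $$ (i, j) = (\<Sum>x\<in>F. f x $$ (i, j))"
  using assms(1,2)
proof (induction F rule: finite_induct)
  case empty
  show ?case
    using comm_monoid.finprod_empty[OF comm_monoid_mat[where 'a = complex and nr = N and nc = N], of f] assms(3,4)
    by (simp add: finsum_mat_def monoid_mat_def)
next
  case (insert x F)
  have F: "f \<in> F \<rightarrow> carrier_mat N N" and x: "f x \<in> carrier_mat N N"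
    using insert.prems by auto
  have "finsum_mat N f (insert x F) = f x + finsum_mat N f F"
    using comm_monoid.finprod_insert[OF comm_monoid_mat[where 'a = complex and nr = N and nc = N], of F x f]
      insert.hyps F x
    by (simp add: finsum_mat_def monoid_mat_def)
  then show ?case
    using insert.IH[OF F] finsum_mat_carrier[OF F] assms(3,4) insert.hyps by auto
qed

text \<open>\<open>A_odd2\<close>, \<open>B1\<close>, \<open>D1\<close> stand for the types \<open>A\<^bsub>2n-1\<^esub>\<^bsup>(2)\<^esup>\<close>, \<open>B\<^bsub>n\<^esub>\<^bsup>(1)\<^esup>\<close>, \<open>D\<^bsub>n\<^esub>\<^bsup>(1)\<^esup>\<close>.\<close>

datatype affine_type = A_odd2 | B1 | D1

fun dimV :: "affine_type \<Rightarrow> nat \<Rightarrow> nat" where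
  "dimV A_odd2 n = 2 * n"
| "dimV B1 n = 2 * n + 1"
| "dimV D1 n = 2 * n"

fun kap :: "affine_type \<Rightarrow> nat \<Rightarrow> complex" where
  "kap A_odd2 n = 2 * of_nat n"
| "kap B1 n = 2 * of_nat n - 1"
| "kap D1 n = 2 * of_nat n - 2"

fun hfun :: "affine_type \<Rightarrow> complex \<Rightarrow> complex" where
  "hfun A_odd2 = cosh"
| "hfun B1 = sinh"
| "hfun D1 = sinh"

fun sig :: "affine_type \<Rightarrow> complex" where
  "sig A_odd2 = - 1"
| "sig B1 = 1"
| "sig D1 = 1"

definition conj_idx :: "nat \<Rightarrow> nat \<Rightarrow> nat" where
  "conj_idx d \<alpha> = d + 1 - \<alpha>"

definition eps :: "affine_type \<Rightarrow> nat \<Rightarrow> nat \<Rightarrow> complex" where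
  "eps T n \<alpha> = (if T = A_odd2 \<and> n + 1 \<le> \<alpha> then - 1 else 1)"

definition bar_idx :: "affine_type \<Rightarrow> nat \<Rightarrow> nat \<Rightarrow> complex" where
  "bar_idx T n \<alpha> =
     (if T = A_odd2 then
        (if \<alpha> \<le> n then of_nat \<alpha> - 1 / 2 else of_nat \<alpha> + 1 / 2)
      else
        (if 2 * \<alpha> < dimV T n + 1 then of_nat \<alpha> + 1 / 2
         else if 2 * \<alpha> = dimV T n + 1 then of_nat \<alpha>
         else of_nat \<alpha> - 1 / 2))"

definition c_fun :: "affine_type \<Rightarrow> nat \<Rightarrow> complex \<Rightarrow> complex \<Rightarrow> complex" where
  "c_fun T n \<eta> u = 2 * sinh (u / 2 - 2 * \<eta>) * hfun T (u / 2 - kap T n * \<eta>)"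

definition b_fun :: "affine_type \<Rightarrow> nat \<Rightarrow> complex \<Rightarrow> complex \<Rightarrow> complex" where
  "b_fun T n \<eta> u = 2 * sinh (u / 2) * hfun T (u / 2 - kap T n * \<eta>)"

definition e_fun :: "affine_type \<Rightarrow> nat \<Rightarrow> complex \<Rightarrow> complex \<Rightarrow> complex" where
  "e_fun T n \<eta> u = - 2 * exp (- u / 2) * sinh (2 * \<eta>) * hfun T (u / 2 - kap T n * \<eta>)"

definition ebar_fun :: "affine_type \<Rightarrow> nat \<Rightarrow> complex \<Rightarrow> complex \<Rightarrow> complex" where
  "ebar_fun T n \<eta> u = exp u * e_fun T n \<eta> u"

definition a_fun :: "affine_type \<Rightarrow> nat \<Rightarrow> complex \<Rightarrow> nat \<Rightarrow> nat \<Rightarrow> complex \<Rightarrow> complex" where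
  "a_fun T n \<eta> \<alpha> \<beta> u =
    (let \<beta>' = conj_idx (dimV T n) \<beta>; \<kappa> = kap T n; \<delta> = (if \<alpha> = \<beta>' then 1 else 0) in
     if \<alpha> = \<beta> then
       (if \<alpha> \<noteq> \<beta>' then 2 * sinh (u / 2) * hfun T (u / 2 - (\<kappa> - 2) * \<eta>)
        else b_fun T n \<eta> u + 2 * sinh (2 * \<eta>) * sinh ((2 * of_nat n - 1) * \<eta>))
     else if \<alpha> < \<beta> then
       2 * sinh (2 * \<eta>) * exp (- u / 2) *
         (sig T * eps T n \<alpha> * eps T n \<beta>
            * exp ((\<kappa> + 2 * (bar_idx T n \<alpha> - bar_idx T n \<beta>)) * \<eta>) * sinh (u / 2)
          - \<delta> * hfun T (u / 2 - \<kappa> * \<eta>))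
     else
       2 * sinh (2 * \<eta>) * exp (u / 2) *
         (eps T n \<alpha> * eps T n \<beta>
            * exp ((- \<kappa> + 2 * (bar_idx T n \<alpha> - bar_idx T n \<beta>)) * \<eta>) * sinh (u / 2)
          - \<delta> * hfun T (u / 2 - \<kappa> * \<eta>)))"

definition R_mat :: "affine_type \<Rightarrow> nat \<Rightarrow> complex \<Rightarrow> complex \<Rightarrow> complex mat" where
  "R_mat T n \<eta> u =
    (let d = dimV T n; I = {1..d}; E = elem_mat d; pr = conj_idx d; N = d * d in
       c_fun T n \<eta> u \<cdot>\<^sub>m finsum_mat N (\<lambda>\<alpha>. kron (E \<alpha> \<alpha>) (E \<alpha> \<alpha>)) {\<alpha> \<in> I. \<alpha> \<noteq> pr \<alpha>}
     + b_fun T n \<eta> u \<cdot>\<^sub>m finsum_mat N (\<lambda>(\<alpha>, \<beta>). kron (E \<alpha> \<alpha>) (E \<beta> \<beta>))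
                          {(\<alpha>, \<beta>) \<in> I \<times> I. \<alpha> \<noteq> \<beta> \<and> \<alpha> \<noteq> pr \<beta>}
     + (e_fun T n \<eta> u \<cdot>\<^sub>m finsum_mat N (\<lambda>(\<alpha>, \<beta>). kron (E \<alpha> \<beta>) (E \<beta> \<alpha>))
                          {(\<alpha>, \<beta>) \<in> I \<times> I. \<alpha> < \<beta> \<and> \<alpha> \<noteq> pr \<beta>}
        + ebar_fun T n \<eta> u \<cdot>\<^sub>m finsum_mat N (\<lambda>(\<alpha>, \<beta>). kron (E \<alpha> \<beta>) (E \<beta> \<alpha>))
                          {(\<alpha>, \<beta>) \<in> I \<times> I. \<alpha> > \<beta> \<and> \<alpha> \<noteq> pr \<beta>})
     + finsum_mat N (\<lambda>(\<alpha>, \<beta>). a_fun T n \<eta> \<alpha> \<beta> u \<cdot>\<^sub>m kron (E \<alpha> \<beta>) (E (pr \<alpha>) (pr \<beta>))) (I \<times> I))"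

definition rho :: "affine_type \<Rightarrow> nat \<Rightarrow> complex \<Rightarrow> complex" where
  "rho T n \<eta> = (if T = A_odd2 then - 2 * kap T n * \<eta> - \<i> * of_real pi else - 2 * kap T n * \<eta>)"

definition gam :: "affine_type \<Rightarrow> nat \<Rightarrow> complex \<Rightarrow> complex \<Rightarrow> nat \<Rightarrow> complex" where
  "gam T n \<eta> \<gamma>\<^sub>0 p = \<gamma>\<^sub>0 * exp ((4 * of_nat p - 2) * \<eta> + rho T n \<eta> / 2)"

text \<open>
  At the zeros of \<open>\<gamma> + e\<^sup>u\<close> the middle entries take the value 0 by the convention for division
  by zero; this affects a discrete set of \<open>u\<close> only.
\<close>

definition KR_mat :: "affine_type \<Rightarrow> nat \<Rightarrow> complex \<Rightarrow> complex \<Rightarrow> complex \<Rightarrow> nat \<Rightarrow> complex mat" where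
  "KR_mat T n \<eta> \<gamma>\<^sub>0 u p =
    (let d = dimV T n; \<gamma> = gam T n \<eta> \<gamma>\<^sub>0 p in
     mat d d (\<lambda>(i, j).
       if i \<noteq> j then 0
       else if i < p then exp (- u)
       else if i < d - p then (\<gamma> * exp u + 1) / (\<gamma> + exp u)
       else exp u))"

definition M_mat :: "affine_type \<Rightarrow> nat \<Rightarrow> complex \<Rightarrow> complex mat" where
  "M_mat T n \<eta> =
    (let d = dimV T n; vs = (if T = A_odd2 then - 1 else 1) in
     mat d d (\<lambda>(i, j).
       if i = j then vs * exp (4 * ((of_nat d + 1) / 2 - bar_idx T n (i + 1)) * \<eta>) else 0))"

definition KL_mat :: "affine_type \<Rightarrow> nat \<Rightarrow> complex \<Rightarrow> complex \<Rightarrow> complex \<Rightarrow> nat \<Rightarrow> complex mat" where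
  "KL_mat T n \<eta> \<gamma>\<^sub>0 u p = KR_mat T n \<eta> \<gamma>\<^sub>0 (- u - rho T n \<eta>) p * M_mat T n \<eta>"

definition Zr_mat :: "nat \<Rightarrow> complex mat" where
  "Zr_mat d = mat d d (\<lambda>(i, j).
     if i = 0 \<and> j = d - 1 then 1
     else if i = d - 1 \<and> j = 0 then 1
     else if i = j \<and> 0 < i \<and> i < d - 1 then 1
     else 0)"

definition Y_mat :: "nat \<Rightarrow> complex \<Rightarrow> complex mat" where
  "Y_mat d u = mat d d (\<lambda>(i, j).
     if i = 0 \<and> j = d - 1 then exp (- u)
     else if i = d - 1 \<and> j = 0 then exp u
     else if i = j \<and> 0 < i \<and> i < d - 1 then 1
     else 0)"

end

theory Submission
  imports Defs
begin

text \<open>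
  All of \<open>Zr_mat d\<close>, \<open>Y_mat d u\<close> and its transpose are monomial with the same underlying
  permutation \<open>s\<close>, which exchanges the first and the last basis vector; the weights of the transpose
  of \<open>Y_mat d u\<close> are \<open>w 0 = exp u\<close>, \<open>w (d - 1) = exp (- u)\<close> and 1 otherwise, those of \<open>Y_mat d u\<close>
  their inverses. Comparing entries, both identities for the
  R-matrix become \<open>r i k j l = (w k / w l) * r (s i) (s k) (s j) (s l)\<close> and the same with
  \<open>w j / w i\<close> in place of \<open>w k / w l\<close>, and these factors agree because \<open>r i k j l \<noteq> 0\<close> forces
  \<open>w i * w k = w j * w l\<close>. The transformation rule itself rests on
  \<open>bar_idx T n d - bar_idx T n 1 = kap T n\<close>.
\<close>

section \<open>Monomial matrices\<close>

text \<open>The weight belongs to the row: multiplication from the left scales by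
  \<open>w i\<close>, multiplication from the right by the weight of the row that meets the given
  column.\<close>

definition mono_mat :: "nat \<Rightarrow> (nat \<Rightarrow> nat) \<Rightarrow> (nat \<Rightarrow> complex) \<Rightarrow> complex mat" where
  "mono_mat N s w = mat N N (\<lambda>(i, j). if j = s i then w i else 0)"

lemma mono_mat_carrier [simp]: "mono_mat N s w \<in> carrier_mat N N"
  by (simp add: mono_mat_def)

lemma mono_mat_dim [simp]: "dim_row (mono_mat N s w) = N" "dim_col (mono_mat N s w) = N"
  by (simp_all add: mono_mat_def)

lemma one_mat_eq_mono_mat: "1\<^sub>m N = mono_mat N (\<lambda>i. i) (\<lambda>_. 1)"
  by (rule eq_matI) (auto simp: mono_mat_def)

lemma kron_mono_mat:
  assumes "\<And>i. i < d \<Longrightarrow> t i < d"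
  shows "kron (mono_mat d s v) (mono_mat d t w)
    = mono_mat (d * d) (\<lambda>I. s (I div d) * d + t (I mod d)) (\<lambda>I. v (I div d) * w (I mod d))"
proof (rule eq_matI)
  fix I J
  assume "I < dim_row (mono_mat (d * d) (\<lambda>I. s (I div d) * d + t (I mod d)) (\<lambda>I. v (I div d) * w (I mod d)))"
    and "J < dim_col (mono_mat (d * d) (\<lambda>I. s (I div d) * d + t (I mod d)) (\<lambda>I. v (I div d) * w (I mod d)))"
  then have IJ: "I < d * d" "J < d * d"
    by simp_all
  then have d: "0 < d"
    by (cases d) auto
  have bounds: "I div d < d" "J div d < d" "I mod d < d" "J mod d < d"
    using IJ d by (auto simp: less_mult_imp_div_less)
  have t: "t (I mod d) < d"
    using assms bounds by auto
  \<comment> \<open>Uniqueness of division with remainder: \<open>t (I mod d)\<close> lies below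
    \<open>d\<close>, so it is the remainder.\<close>
  have "J = s (I div d) * d + t (I mod d) \<longleftrightarrow> J div d = s (I div d) \<and> J mod d = t (I mod d)"
    using t d by (metis div_mult_mod_eq mod_less mod_mult_self3 div_mult_self3 div_less add_0_right less_nat_zero_code)
  then show "kron (mono_mat d s v) (mono_mat d t w) $$ (I, J)
      = mono_mat (d * d) (\<lambda>I. s (I div d) * d + t (I mod d)) (\<lambda>I. v (I div d) * w (I mod d)) $$ (I, J)"
    using IJ bounds by (simp add: kron_def mono_mat_def)
qed (simp_all add: kron_def)

lemma index_mono_mat_mult:
  assumes "A \<in> carrier_mat N N" "s i < N" "i < N" "j < N"
  shows "(mono_mat N s w * A) $$ (i, j) = w i * A $$ (s i, j)"
proof -
  have "(mono_mat N s w * A) $$ (i, j) = (\<Sum>m<N. mono_mat N s w $$ (i, m) * A $$ (m, j))"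
    using assms by (simp add: scalar_prod_def atLeast0LessThan)
  also have "\<dots> = (\<Sum>m<N. if m = s i then w i * A $$ (m, j) else 0)"
    using assms by (intro sum.cong) (auto simp: mono_mat_def)
  finally show ?thesis
    using assms by simp
qed

text \<open>As \<open>s\<close> is an involution, the row that meets column \<open>j\<close> is
  \<open>s j\<close>; hence the weight is taken at \<open>s j\<close>.\<close>

lemma index_mult_mono_mat:
  assumes "A \<in> carrier_mat N N" "\<And>i. i < N \<Longrightarrow> s i < N" "\<And>i. i < N \<Longrightarrow> s (s i) = i" "i < N" "j < N"
  shows "(A * mono_mat N s w) $$ (i, j) = A $$ (i, s j) * w (s j)"
proof -
  have "(A * mono_mat N s w) $$ (i, j) = (\<Sum>m<N. A $$ (i, m) * mono_mat N s w $$ (m, j))"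
    using assms by (simp add: scalar_prod_def atLeast0LessThan)
  also have "\<dots> = (\<Sum>m<N. if m = s j then A $$ (i, m) * w m else 0)"
    using assms by (intro sum.cong) (auto simp: mono_mat_def)
  finally show ?thesis
    using assms by simp
qed

lemma index_mono_mat_sandwich:
  assumes "A \<in> carrier_mat N N" "\<And>i. i < N \<Longrightarrow> s i < N" "\<And>i. i < N \<Longrightarrow> s (s i) = i" "i < N" "j < N"
  shows "(mono_mat N s v * A * mono_mat N s w) $$ (i, j) = v i * A $$ (s i, s j) * w (s j)"
proof -
  have "mono_mat N s v * A \<in> carrier_mat N N"
    using assms(1) by (intro mult_carrier_mat[of _ N N]) auto
  then show ?thesis
    using assms index_mult_mono_mat[of "mono_mat N s v * A" N s i j w]
      index_mono_mat_mult[of A N s i "s j" v] by simp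
qed

section \<open>The exchange of the two end vectors and its weights\<close>

definition end_swap :: "nat \<Rightarrow> nat \<Rightarrow> nat" where
  "end_swap d i = (if i = 0 then d - 1 else if i = d - 1 then 0 else i)"

definition end_weight :: "nat \<Rightarrow> complex \<Rightarrow> nat \<Rightarrow> complex" where
  "end_weight d u i = (if i = 0 then exp u else if i = d - 1 then exp (- u) else 1)"

lemma end_swap_less: "i < d \<Longrightarrow> end_swap d i < d"
  by (auto simp: end_swap_def)

lemma end_swap_involution: "end_swap d (end_swap d i) = i"
  by (auto simp: end_swap_def)

lemma end_swap_eq_iff [simp]: "end_swap d i = end_swap d j \<longleftrightarrow> i = j"
  by (metis end_swap_involution)

text \<open>The ends 0 and \<open>d - 1\<close> are conjugate to each other, so exchanging them
  carries conjugate pairs to conjugate pairs.\<close>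

lemma end_swap_opposite:
  assumes "i < d" "j < d"
  shows "Suc (end_swap d i + end_swap d j) = d \<longleftrightarrow> Suc (i + j) = d"
  using assms by (auto simp: end_swap_def)

lemma end_weight_nonzero [simp]: "end_weight d u i \<noteq> 0"
  by (simp add: end_weight_def)

lemma end_weight_swap:
  assumes "2 \<le> d"
  shows "end_weight d u (end_swap d i) = 1 / end_weight d u i"
  using assms by (auto simp: end_weight_def end_swap_def exp_minus field_simps)

lemma end_weight_uminus:
  assumes "2 \<le> d"
  shows "end_weight d (- u) i = 1 / end_weight d u i"
  using assms by (auto simp: end_weight_def exp_minus field_simps)

lemma end_weight_opposite:
  assumes "2 \<le> d" "Suc (i + k) = d"
  shows "end_weight d u k = 1 / end_weight d u i"
  using assms by (auto simp: end_weight_def exp_minus field_simps)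

lemma Zr_mat_eq_mono_mat:
  assumes "2 \<le> d"
  shows "Zr_mat d = mono_mat d (end_swap d) (\<lambda>_. 1)"
  using assms by (intro eq_matI) (auto simp: Zr_mat_def mono_mat_def end_swap_def)

lemma Y_mat_eq_mono_mat:
  assumes "2 \<le> d"
  shows "Y_mat d u = mono_mat d (end_swap d) (end_weight d (- u))"
  using assms by (intro eq_matI) (auto simp: Y_mat_def mono_mat_def end_swap_def end_weight_def)

lemma transpose_Y_mat_eq_mono_mat:
  assumes "2 \<le> d"
  shows "transpose_mat (Y_mat d u) = mono_mat d (end_swap d) (end_weight d u)"
  using assms by (intro eq_matI) (auto simp: Y_mat_def mono_mat_def end_swap_def end_weight_def)

section \<open>Entries of the R-matrix\<close>

text \<open>One coefficient for both exchange sums of the R-matrix. The value 0 at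
  \<open>i = j\<close> reflects that neither sum has a diagonal term.\<close>

definition exch_fun :: "affine_type \<Rightarrow> nat \<Rightarrow> complex \<Rightarrow> complex \<Rightarrow> nat \<Rightarrow> nat \<Rightarrow> complex" where
  "exch_fun T n \<eta> u i j = (if i < j then e_fun T n \<eta> u else if j < i then ebar_fun T n \<eta> u else 0)"

text \<open>Indices are counted from 0 here, so that \<open>Suc (i + k) = d\<close> says that the labels are conjugate.\<close>

definition R_entry :: "affine_type \<Rightarrow> nat \<Rightarrow> complex \<Rightarrow> complex \<Rightarrow> nat \<Rightarrow> nat \<Rightarrow> nat \<Rightarrow> nat \<Rightarrow> complex" where
  "R_entry T n \<eta> u i k j l =
    (let d = dimV T n in
       (if i = j \<and> k = l \<and> i = k \<and> Suc (i + i) \<noteq> d then c_fun T n \<eta> u else 0)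
     + (if i = j \<and> k = l \<and> i \<noteq> k \<and> Suc (i + k) \<noteq> d then b_fun T n \<eta> u else 0)
     + (if i = l \<and> k = j \<and> Suc (i + j) \<noteq> d then exch_fun T n \<eta> u i j else 0)
     + (if Suc (i + k) = d \<and> Suc (j + l) = d then a_fun T n \<eta> (Suc i) (Suc j) u else 0))"

lemma pair_index_less:
  assumes "i < d" "k < d"
  shows "i * d + k < d * (d::nat)"
proof -
  have "i * d + k < Suc i * d"
    using assms by simp
  also have "\<dots> \<le> d * d"
    using assms by (intro mult_le_mono1) simp
  finally show ?thesis .
qed

lemma index_kron_elem_mat:
  assumes "i < d" "k < d" "j < d" "l < d"
  shows "kron (elem_mat d \<alpha> \<beta>) (elem_mat d \<alpha>' \<beta>') $$ (i * d + k, j * d + l)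
    = (if Suc i = \<alpha> \<and> Suc j = \<beta> \<and> Suc k = \<alpha>' \<and> Suc l = \<beta>' then 1 else 0)"
  using assms pair_index_less[of i d k] pair_index_less[of j d l]
  by (auto simp: kron_def elem_mat_def)

lemma elem_mat_carrier: "elem_mat d \<alpha> \<beta> \<in> carrier_mat d d"
  by (simp add: elem_mat_def)

lemmas kron_elem_mat_carrier = kron_carrier[OF elem_mat_carrier elem_mat_carrier]

lemma conj_idx_Suc_iff: "j < d \<Longrightarrow> Suc i = conj_idx d (Suc j) \<longleftrightarrow> Suc (i + j) = d"
  by (auto simp: conj_idx_def)

text \<open>A nonzero entry of a Kronecker product of elementary matrices determines the labels, so
  at a given position each of the five sums in \<open>R_mat\<close> has at most one contributing
  summand.\<close>

lemma index_finsum_mat_single: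
  assumes "finite F" "f \<in> F \<rightarrow> carrier_mat N N" "I < N" "J < N"
    and "\<And>x. x \<in> F \<Longrightarrow> x \<noteq> a \<Longrightarrow> f x $$ (I, J) = 0"
  shows "finsum_mat N f F $$ (I, J) = (if a \<in> F then f a $$ (I, J) else 0)"
proof -
  have "finsum_mat N f F $$ (I, J) = (\<Sum>x\<in>F. f x $$ (I, J))"
    using assms(1-4) by (rule index_finsum_mat)
  also have "\<dots> = (\<Sum>x\<in>F. if x = a then f a $$ (I, J) else 0)"
    using assms(5) by (intro sum.cong) auto
  finally show ?thesis
    using assms(1) by simp
qed

lemma R_mat_carrier: "R_mat T n \<eta> u \<in> carrier_mat (dimV T n * dimV T n) (dimV T n * dimV T n)"
  unfolding R_mat_def Let_def
  by (intro add_carrier_mat smult_carrier_mat finsum_mat_carrier)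
     (auto intro!: kron_elem_mat_carrier smult_carrier_mat)

lemma index_mat_lincomb:
  fixes A B C L U :: "complex mat"
  assumes "C \<in> carrier_mat N N" "B \<in> carrier_mat N N" "U \<in> carrier_mat N N" "L \<in> carrier_mat N N"
    "A \<in> carrier_mat N N" "I < N" "J < N"
  shows "(c \<cdot>\<^sub>m C + b \<cdot>\<^sub>m B + (e \<cdot>\<^sub>m U + f \<cdot>\<^sub>m L) + A) $$ (I, J)
    = c * C $$ (I, J) + b * B $$ (I, J) + (e * U $$ (I, J) + f * L $$ (I, J)) + A $$ (I, J)"
  using assms by simp

lemma index_R_mat:
  assumes "d = dimV T n" "i < d" "k < d" "j < d" "l < d"
  shows "R_mat T n \<eta> u $$ (i * d + k, j * d + l) = R_entry T n \<eta> u i k j l"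
proof -
  let ?I = "i * d + k" and ?J = "j * d + l" and ?N = "d * d" and ?E = "elem_mat d" and ?pr = "conj_idx d"
  let ?D = "{1..d} \<times> {1..d}"
  let ?C = "finsum_mat ?N (\<lambda>\<alpha>. kron (?E \<alpha> \<alpha>) (?E \<alpha> \<alpha>)) {\<alpha> \<in> {1..d}. \<alpha> \<noteq> ?pr \<alpha>}"
  let ?B = "finsum_mat ?N (\<lambda>(\<alpha>, \<beta>). kron (?E \<alpha> \<alpha>) (?E \<beta> \<beta>)) {(\<alpha>, \<beta>) \<in> ?D. \<alpha> \<noteq> \<beta> \<and> \<alpha> \<noteq> ?pr \<beta>}"
  let ?U = "finsum_mat ?N (\<lambda>(\<alpha>, \<beta>). kron (?E \<alpha> \<beta>) (?E \<beta> \<alpha>)) {(\<alpha>, \<beta>) \<in> ?D. \<alpha> < \<beta> \<and> \<alpha> \<noteq> ?pr \<beta>}"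
  let ?L = "finsum_mat ?N (\<lambda>(\<alpha>, \<beta>). kron (?E \<alpha> \<beta>) (?E \<beta> \<alpha>)) {(\<alpha>, \<beta>) \<in> ?D. \<alpha> > \<beta> \<and> \<alpha> \<noteq> ?pr \<beta>}"
  let ?A = "finsum_mat ?N (\<lambda>(\<alpha>, \<beta>). a_fun T n \<eta> \<alpha> \<beta> u \<cdot>\<^sub>m kron (?E \<alpha> \<beta>) (?E (?pr \<alpha>) (?pr \<beta>))) ?D"
  have IJ: "?I < ?N" "?J < ?N"
    using assms pair_index_less by auto
  have fin: "finite {(\<alpha>, \<beta>) \<in> ?D. P \<alpha> \<beta>}" for P
    by (rule finite_subset[of _ ?D]) auto
  note carriers = kron_elem_mat_carrier smult_carrier_mat
  note entry = index_kron_elem_mat conj_idx_Suc_iff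
  have smult: "(x \<cdot>\<^sub>m kron (?E \<alpha> \<beta>) (?E \<alpha>' \<beta>')) $$ (?I, ?J) = x * kron (?E \<alpha> \<beta>) (?E \<alpha>' \<beta>') $$ (?I, ?J)"
    for x \<alpha> \<beta> \<alpha>' \<beta>'
    using kron_elem_mat_carrier[of d \<alpha> \<beta> \<alpha>' \<beta>'] IJ by simp
  \<comment> \<open>The candidate summand has labels one larger than the indices: the first label
    comes from \<open>i\<close>, the second from \<open>k\<close> in the diagonal sum
    \<open>?B\<close> and from \<open>j\<close> in \<open>?U\<close>, \<open>?L\<close> and
    \<open>?A\<close>.\<close>
  have C: "?C $$ (?I, ?J) = (if i = j \<and> k = l \<and> i = k \<and> Suc (i + i) \<noteq> d then 1 else 0)"
    using assms(2-5) IJ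
    by (subst index_finsum_mat_single[where a = "Suc i"]) (auto intro: carriers simp: entry split: if_splits)
  have B: "?B $$ (?I, ?J) = (if i = j \<and> k = l \<and> i \<noteq> k \<and> Suc (i + k) \<noteq> d then 1 else 0)"
    using assms(2-5) IJ fin
    by (subst index_finsum_mat_single[where a = "(Suc i, Suc k)"]) (auto intro: carriers simp: entry split: if_splits)
  have U: "?U $$ (?I, ?J) = (if i = l \<and> k = j \<and> i < j \<and> Suc (i + j) \<noteq> d then 1 else 0)"
    using assms(2-5) IJ fin
    by (subst index_finsum_mat_single[where a = "(Suc i, Suc j)"]) (auto intro: carriers simp: entry split: if_splits)
  have L: "?L $$ (?I, ?J) = (if i = l \<and> k = j \<and> j < i \<and> Suc (i + j) \<noteq> d then 1 else 0)"
    using assms(2-5) IJ fin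
    by (subst index_finsum_mat_single[where a = "(Suc i, Suc j)"]) (auto intro: carriers simp: entry split: if_splits)
  have A: "?A $$ (?I, ?J) = (if Suc (i + k) = d \<and> Suc (j + l) = d then a_fun T n \<eta> (Suc i) (Suc j) u else 0)"
    using assms(2-5) IJ
    by (subst index_finsum_mat_single[where a = "(Suc i, Suc j)"])
       (auto intro: carriers simp: smult entry conj_idx_def split: if_splits)
  have car: "?C \<in> carrier_mat ?N ?N" "?B \<in> carrier_mat ?N ?N" "?U \<in> carrier_mat ?N ?N"
      "?L \<in> carrier_mat ?N ?N" "?A \<in> carrier_mat ?N ?N"
    by (intro finsum_mat_carrier; auto intro!: carriers)+
  have "R_mat T n \<eta> u = c_fun T n \<eta> u \<cdot>\<^sub>m ?C + b_fun T n \<eta> u \<cdot>\<^sub>m ?B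
      + (e_fun T n \<eta> u \<cdot>\<^sub>m ?U + ebar_fun T n \<eta> u \<cdot>\<^sub>m ?L) + ?A"
    by (simp add: R_mat_def Let_def assms(1))
  then have "R_mat T n \<eta> u $$ (?I, ?J) = c_fun T n \<eta> u * ?C $$ (?I, ?J) + b_fun T n \<eta> u * ?B $$ (?I, ?J)
      + (e_fun T n \<eta> u * ?U $$ (?I, ?J) + ebar_fun T n \<eta> u * ?L $$ (?I, ?J)) + ?A $$ (?I, ?J)"
    by (simp only: index_mat_lincomb[OF car IJ])
  then show ?thesis
    unfolding C B U L A R_entry_def exch_fun_def Let_def assms(1)[symmetric] by simp
qed

section \<open>Behaviour of the coefficients when the end labels are exchanged\<close>

text \<open>The end labels are \<open>d - 1\<close> apart; the half-integer shifts widen this by 1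
  for \<open>A_odd2\<close> and narrow it by 1 for \<open>B1\<close> and \<open>D1\<close>.\<close>

lemma bar_idx_ends:
  assumes "1 \<le> n"
  shows "bar_idx T n (dimV T n) = bar_idx T n 1 + kap T n"
  using assms by (cases T) (auto simp: bar_idx_def of_nat_diff)

text \<open>The sign that distinguishes the case \<alpha> < \<beta> of \<open>a_fun\<close> is that
  of the last label, so it is absorbed when an end label changes sides.\<close>

lemma sig_eps_ends:
  assumes "1 \<le> n"
  shows "sig T = eps T n (dimV T n)" "eps T n 1 = 1" "eps T n (dimV T n) ^ 2 = 1"
  using assms by (cases T; simp add: eps_def)+

lemma dimV_ge_2: "1 \<le> n \<Longrightarrow> 2 \<le> dimV T n"
  by (cases T) auto

lemma exp_minus_double: "exp (- (2 * v)) = exp (- v) * exp (- v :: complex)"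
  by (simp flip: exp_add)

text \<open>In exponentials, the left side is \<open>exp (- v) * sinh y\<close> and the bracket on
  the right is \<open>exp v * sinh y\<close>.\<close>

lemma sinh_corner:
  fixes v y :: complex
  shows "exp (- y) * sinh v - sinh (v - y) = exp (- (2 * v)) * (exp y * sinh v - sinh (v - y))"
  unfolding exp_minus_double by (simp add: sinh_field_def exp_minus exp_diff field_simps)

text \<open>The counterpart for \<open>A_odd2\<close>: the two sides reduce to
  \<open>- exp (- v) * cosh y\<close> and the bracket \<open>- exp v * cosh y\<close>. The minus
  sign before \<open>exp y\<close> is \<open>sig\<close>.\<close>

lemma cosh_corner:
  fixes v y :: complex
  shows "exp (- y) * sinh v - cosh (v - y) = exp (- (2 * v)) * (- exp y * sinh v - cosh (v - y))"
  unfolding exp_minus_double by (simp add: sinh_field_def cosh_field_def exp_minus exp_diff field_simps)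

text \<open>The labels 1 and d are conjugate, so both entries contain the Kronecker delta term. One
  factor \<open>exp (- u)\<close> comes from the prefactors, the other from the brackets.\<close>

lemma a_fun_corners:
  assumes "1 \<le> n"
  shows "a_fun T n \<eta> 1 (dimV T n) u = exp (- 2 * u) * a_fun T n \<eta> (dimV T n) 1 u"
proof -
  let ?d = "dimV T n" and ?k = "kap T n * \<eta>"
  have d: "2 \<le> ?d"
    using assms by (rule dimV_ge_2)
  have bar: "kap T n + 2 * (bar_idx T n 1 - bar_idx T n ?d) = - kap T n"
    "- kap T n + 2 * (bar_idx T n ?d - bar_idx T n 1) = kap T n"
    using bar_idx_ends[OF assms, of T] by (simp_all add: algebra_simps)
  have signs: "sig T * eps T n 1 * eps T n ?d = 1" "eps T n ?d * eps T n 1 = sig T"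
    using sig_eps_ends[OF assms, of T] by (simp_all add: power2_eq_square)
  have idx: "1 = conj_idx ?d ?d" "?d = conj_idx ?d 1" "1 \<noteq> ?d" "?d \<noteq> 1" "1 < ?d" "\<not> ?d < 1"
    using d by (simp_all add: conj_idx_def)
  \<comment> \<open>Both hyperbolic identities in one form, at v = u / 2 and y = \<open>?k\<close>,
    with \<open>sig\<close> selecting the sign.\<close>
  have hyp: "exp (- ?k) * sinh (u / 2) - hfun T (u / 2 - ?k)
      = exp (- u) * (sig T * exp ?k * sinh (u / 2) - hfun T (u / 2 - ?k))"
    using sinh_corner[of ?k "u / 2"] cosh_corner[of ?k "u / 2"] by (cases T) simp_all
  have first: "a_fun T n \<eta> 1 ?d u = 2 * sinh (2 * \<eta>) * exp (- u / 2)
      * (exp (- ?k) * sinh (u / 2) - hfun T (u / 2 - ?k))"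
    using idx signs bar
    by (simp only: a_fun_def Let_def if_True if_False refl mult_1_left mult_minus_left mult.assoc)
  have last: "a_fun T n \<eta> ?d 1 u = 2 * sinh (2 * \<eta>) * exp (u / 2)
      * (sig T * exp ?k * sinh (u / 2) - hfun T (u / 2 - ?k))"
    using idx signs bar
    by (simp only: a_fun_def Let_def if_True if_False refl mult_1_left mult_minus_left mult.assoc)
  have "exp (- u / 2) * exp (- u) = exp (- 2 * u) * exp (u / 2)"
    by (simp flip: exp_add)
  then show ?thesis
    unfolding first last hyp by (simp add: mult_ac)
qed

text \<open>An interior \<beta> is conjugate to neither end, so no delta term occurs. Signs and
  exponents agree by the relations between the ends, and only the prefactors
  \<open>exp (- u / 2)\<close> and \<open>exp (u / 2)\<close> differ.\<close>

lemma a_fun_edge_row: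
  assumes "1 \<le> n" "1 < \<beta>" "\<beta> < dimV T n"
  shows "a_fun T n \<eta> 1 \<beta> u = exp (- u) * a_fun T n \<eta> (dimV T n) \<beta> u"
proof -
  let ?d = "dimV T n"
  have "- kap T n + 2 * (bar_idx T n ?d - bar_idx T n \<beta>) = kap T n + 2 * (bar_idx T n 1 - bar_idx T n \<beta>)"
    using bar_idx_ends[OF assms(1), of T] by (simp add: algebra_simps)
  moreover have "sig T * eps T n 1 = eps T n ?d"
    using sig_eps_ends[OF assms(1), of T] by simp
  moreover have "1 \<noteq> conj_idx ?d \<beta>" "?d \<noteq> conj_idx ?d \<beta>" "1 \<noteq> \<beta>" "?d \<noteq> \<beta>" "\<not> ?d < \<beta>"
    using assms by (auto simp: conj_idx_def)
  moreover have "exp (- u / 2) = exp (- u) * exp (u / 2)"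
    by (simp flip: exp_add)
  ultimately show ?thesis
    using assms(2) by (simp only: a_fun_def Let_def if_True if_False mult_zero_left diff_zero mult_ac)
qed

lemma a_fun_edge_col:
  assumes "1 \<le> n" "1 < \<alpha>" "\<alpha> < dimV T n"
  shows "a_fun T n \<eta> \<alpha> 1 u = exp u * a_fun T n \<eta> \<alpha> (dimV T n) u"
proof -
  let ?d = "dimV T n"
  have "kap T n + 2 * (bar_idx T n \<alpha> - bar_idx T n ?d) = - kap T n + 2 * (bar_idx T n \<alpha> - bar_idx T n 1)"
    using bar_idx_ends[OF assms(1), of T] by (simp add: algebra_simps)
  moreover have "sig T * eps T n \<alpha> * eps T n ?d = eps T n \<alpha> * eps T n 1"
    using sig_eps_ends[OF assms(1), of T] by (simp add: power2_eq_square)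
  moreover have "exp (u / 2) = exp u * exp (- u / 2)"
    by (simp flip: exp_add)
  moreover have "\<alpha> \<noteq> conj_idx ?d 1" "\<alpha> \<noteq> conj_idx ?d ?d" "\<alpha> \<noteq> 1" "\<alpha> \<noteq> ?d" "\<not> \<alpha> < 1"
    using assms by (auto simp: conj_idx_def)
  ultimately show ?thesis
    using assms(3) by (simp only: a_fun_def Let_def if_True if_False mult_zero_left diff_zero mult_ac)
qed

text \<open>Each index is first, last or interior. The nine cases are the diagonal ends, the
  corners, the edge rows, the edge columns, and the interior, where the swap and the weights are
  trivial.\<close>

lemma a_fun_end_swap:
  assumes "1 \<le> n" "d = dimV T n" "i < d" "j < d"
  shows "a_fun T n \<eta> (Suc i) (Suc j) u
    = end_weight d u j / end_weight d u i * a_fun T n \<eta> (Suc (end_swap d i)) (Suc (end_swap d j)) u"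
proof -
  have d: "2 \<le> d"
    using dimV_ge_2 assms by simp
  have ends: "a_fun T n \<eta> 1 1 u = a_fun T n \<eta> d d u"
    using d by (simp add: a_fun_def conj_idx_def Let_def assms(2))
  \<comment> \<open>Quotients, to match the shape of the ratio of weights.\<close>
  have exps: "exp (- 2 * u) = exp (- u) / exp u" "exp (2 * u) = exp u / exp (- u)"
    by (simp_all flip: exp_diff)
  note corners = a_fun_corners[OF assms(1), of T \<eta> u, folded assms(2)]
  note row = a_fun_edge_row[OF assms(1), of _ T \<eta> u, folded assms(2)]
  note col = a_fun_edge_col[OF assms(1), of _ T \<eta> u, folded assms(2)]
  consider "i = 0" | "i = d - 1" | "0 < i" "i < d - 1"
    using assms by linarith
  then show ?thesis
  proof cases
    case 1
    consider "j = 0" | "j = d - 1" | "0 < j" "j < d - 1"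
      using assms by linarith
    then show ?thesis
      using 1 d ends corners row[of "Suc j"] exps
      by cases (auto simp: end_swap_def end_weight_def exp_minus field_simps)
  next
    case 2
    consider "j = 0" | "j = d - 1" | "0 < j" "j < d - 1"
      using assms by linarith
    then show ?thesis
      using 2 d ends corners row[of "Suc j"] exps
      by cases (auto simp: end_swap_def end_weight_def exp_minus field_simps)
  next
    case 3
    consider "j = 0" | "j = d - 1" | "0 < j" "j < d - 1"
      using assms by linarith
    then show ?thesis
      using 3 d col[of "Suc i"]
      by cases (auto simp: end_swap_def end_weight_def exp_minus field_simps)
  qed
qed

text \<open>The pair of both ends is excluded. Moving one end past an interior index reverses their
  order and so exchanges \<open>e_fun\<close> with \<open>ebar_fun\<close>, which differ by
  \<open>exp u\<close>.\<close>

lemma exch_fun_end_swap: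
  assumes "2 \<le> d" "i < d" "j < d" "Suc (i + j) \<noteq> d"
  shows "exch_fun T n \<eta> u i j
    = end_weight d u j / end_weight d u i * exch_fun T n \<eta> u (end_swap d i) (end_swap d j)"
  using assms
  by (auto simp: exch_fun_def ebar_fun_def end_swap_def end_weight_def exp_minus divide_inverse)

text \<open>A nonzero entry keeps the pair of indices, exchanges it, or maps a conjugate pair to a
  conjugate pair; in the last case both products are 1.\<close>

lemma R_entry_weight_conservation:
  assumes "1 \<le> n" "d = dimV T n" "R_entry T n \<eta> u i k j l \<noteq> 0"
  shows "end_weight d u i * end_weight d u k = end_weight d u j * end_weight d u l"
proof -
  have "(i = j \<and> k = l) \<or> (i = l \<and> k = j) \<or> (Suc (i + k) = d \<and> Suc (j + l) = d)"
  proof (rule ccontr)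
    assume "\<not> ?thesis"
    then have "R_entry T n \<eta> u i k j l = 0"
      by (cases "i = j"; cases "i = l"; cases "Suc (i + k) = d") (simp_all add: R_entry_def assms(2))
    then show False
      using assms(3) by simp
  qed
  moreover have "2 \<le> d"
    using dimV_ge_2 assms by simp
  ultimately show ?thesis
    using end_weight_opposite[of d i k u] end_weight_opposite[of d j l u] by auto
qed

text \<open>The swap preserves the four case conditions. In the \<open>c_fun\<close> and
  \<open>b_fun\<close> terms \<open>k = l\<close> makes the factor 1; in the exchange term
  (\<open>k = j\<close>, \<open>i = l\<close>) and in the \<open>a_fun\<close> term (inverse weights
  of conjugate indices) it equals the ratio of the weights of \<open>j\<close> and
  \<open>i\<close>.\<close>

lemma R_entry_end_swap:
  assumes "1 \<le> n" "d = dimV T n" "i < d" "k < d" "j < d" "l < d"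
  shows "R_entry T n \<eta> u i k j l = end_weight d u k / end_weight d u l
    * R_entry T n \<eta> u (end_swap d i) (end_swap d k) (end_swap d j) (end_swap d l)"
proof -
  have d: "2 \<le> d"
    using dimV_ge_2 assms by simp
  have R: "R_entry T n \<eta> u i k j l =
       (if i = j \<and> k = l \<and> i = k \<and> Suc (i + i) \<noteq> d then c_fun T n \<eta> u else 0)
     + (if i = j \<and> k = l \<and> i \<noteq> k \<and> Suc (i + k) \<noteq> d then b_fun T n \<eta> u else 0)
     + (if i = l \<and> k = j \<and> Suc (i + j) \<noteq> d then exch_fun T n \<eta> u i j else 0)
     + (if Suc (i + k) = d \<and> Suc (j + l) = d then a_fun T n \<eta> (Suc i) (Suc j) u else 0)"
    for i k j l
    by (simp add: R_entry_def Let_def assms(2))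
  have c: "(if i = j \<and> k = l \<and> i = k \<and> Suc (i + i) \<noteq> d then c_fun T n \<eta> u else 0)
    = end_weight d u k / end_weight d u l * (if i = j \<and> k = l \<and> i = k \<and> Suc (i + i) \<noteq> d then c_fun T n \<eta> u else 0)"
    by simp
  have b: "(if i = j \<and> k = l \<and> i \<noteq> k \<and> Suc (i + k) \<noteq> d then b_fun T n \<eta> u else 0)
    = end_weight d u k / end_weight d u l * (if i = j \<and> k = l \<and> i \<noteq> k \<and> Suc (i + k) \<noteq> d then b_fun T n \<eta> u else 0)"
    by simp
  have e: "(if i = l \<and> k = j \<and> Suc (i + j) \<noteq> d then exch_fun T n \<eta> u i j else 0)
    = end_weight d u k / end_weight d u l
      * (if i = l \<and> k = j \<and> Suc (i + j) \<noteq> d then exch_fun T n \<eta> u (end_swap d i) (end_swap d j) else 0)"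
    using exch_fun_end_swap[OF d assms(3,5), of T n \<eta> u] by auto
  have a: "(if Suc (i + k) = d \<and> Suc (j + l) = d then a_fun T n \<eta> (Suc i) (Suc j) u else 0)
    = end_weight d u k / end_weight d u l * (if Suc (i + k) = d \<and> Suc (j + l) = d
        then a_fun T n \<eta> (Suc (end_swap d i)) (Suc (end_swap d j)) u else 0)"
    using a_fun_end_swap[OF assms(1,2,3,5), of \<eta> u]
      end_weight_opposite[OF d, of i k u] end_weight_opposite[OF d, of j l u] by auto
  show ?thesis
    unfolding R end_swap_eq_iff end_swap_opposite[OF assms(3,3)] end_swap_opposite[OF assms(3,4)]
      end_swap_opposite[OF assms(3,5)] end_swap_opposite[OF assms(5,6)]
    \<comment> \<open>Single substitutions: \<open>c\<close> and \<open>b\<close> repeat their left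
      sides on the right and would loop as rewrite rules.\<close>
    by (subst c, subst b, subst e, subst a) (simp only: distrib_left)
qed

text \<open>This form, with the factor in the indices of the first tensor factor, serves conjugation
  by \<open>Y_mat\<close> there.\<close>

lemma R_entry_end_swap':
  assumes "1 \<le> n" "d = dimV T n" "i < d" "k < d" "j < d" "l < d"
  shows "R_entry T n \<eta> u i k j l = end_weight d u j / end_weight d u i
    * R_entry T n \<eta> u (end_swap d i) (end_swap d k) (end_swap d j) (end_swap d l)"
proof (cases "R_entry T n \<eta> u i k j l = 0")
  case True
  then show ?thesis
    \<comment> \<open>The weights are nonzero, so the swapped entry vanishes as well.\<close>
    using R_entry_end_swap[OF assms, of \<eta> u] by simp
next
  case False
  have "end_weight d u k / end_weight d u l = end_weight d u j / end_weight d u i"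
    using R_entry_weight_conservation[OF assms(1,2) False] by (simp add: field_simps)
  then show ?thesis
    using R_entry_end_swap[OF assms, of \<eta> u] by simp
qed

section \<open>Conjugation of the R-matrix and of the K-matrices\<close>

lemma on_first_end_swap:
  "on_first d (mono_mat d (end_swap d) w)
    = mono_mat (d * d) (\<lambda>I. end_swap d (I div d) * d + I mod d) (\<lambda>I. w (I div d))"
  unfolding on_first_def one_mat_eq_mono_mat by (subst kron_mono_mat) simp_all

lemma on_second_end_swap:
  "on_second d (mono_mat d (end_swap d) w)
    = mono_mat (d * d) (\<lambda>I. I div d * d + end_swap d (I mod d)) (\<lambda>I. w (I mod d))"
  unfolding on_second_def one_mat_eq_mono_mat by (subst kron_mono_mat) (simp_all add: end_swap_less)

lemma pair_indexE:
  assumes "I < d * (d::nat)"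
  obtains i k where "I = i * d + k" "i < d" "k < d"
proof
  show "I = I div d * d + I mod d" "I div d < d" "I mod d < d"
    using assms by (simp, simp add: less_mult_imp_div_less, cases d, auto)
qed

lemma index_on_first_sandwich:
  assumes "A \<in> carrier_mat (d * d) (d * d)" "i < d" "k < d" "j < d" "l < d"
  shows "(on_first d (mono_mat d (end_swap d) v) * A * on_first d (mono_mat d (end_swap d) w)) $$ (i * d + k, j * d + l)
    = v i * A $$ (end_swap d i * d + k, end_swap d j * d + l) * w (end_swap d j)"
proof -
  let ?S = "\<lambda>I. end_swap d (I div d) * d + I mod d"
  have "?S I < d * d" "?S (?S I) = I" if "I < d * d" for I
    using that by (elim pair_indexE, simp add: pair_index_less end_swap_less end_swap_involution)+
  then show ?thesis
    unfolding on_first_end_swap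
    using index_mono_mat_sandwich[OF assms(1), of ?S "i * d + k" "j * d + l"] assms(2-5)
    \<comment> \<open>With \<open>index_mult_mat\<close> in the simpset, entries of products would
      be expanded into scalar products.\<close>
    by (simp add: pair_index_less end_swap_less del: index_mult_mat)
qed

lemma index_on_second_sandwich:
  assumes "A \<in> carrier_mat (d * d) (d * d)" "i < d" "k < d" "j < d" "l < d"
  shows "(on_second d (mono_mat d (end_swap d) v) * A * on_second d (mono_mat d (end_swap d) w)) $$ (i * d + k, j * d + l)
    = v k * A $$ (i * d + end_swap d k, j * d + end_swap d l) * w (end_swap d l)"
proof -
  let ?S = "\<lambda>I. I div d * d + end_swap d (I mod d)"
  have "?S I < d * d" "?S (?S I) = I" if "I < d * d" for I
    using that by (elim pair_indexE, simp add: pair_index_less end_swap_less end_swap_involution)+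
  then show ?thesis
    unfolding on_second_end_swap
    using index_mono_mat_sandwich[OF assms(1), of ?S "i * d + k" "j * d + l"] assms(2-5)
    by (simp add: pair_index_less end_swap_less del: index_mult_mat)
qed

lemma pair_index_eq_matI:
  assumes "dim_row A = d * d" "dim_col A = d * d" "dim_row B = d * d" "dim_col B = d * d"
    and "\<And>i k j l. i < d \<Longrightarrow> k < d \<Longrightarrow> j < d \<Longrightarrow> l < d
      \<Longrightarrow> A $$ (i * d + k, j * d + l) = B $$ (i * d + k, j * d + l)"
  shows "A = B"
proof (rule eq_matI)
  fix I J
  assume "I < dim_row B" "J < dim_col B"
  then show "A $$ (I, J) = B $$ (I, J)"
    using assms(3-5) by (metis pair_indexE)
qed (use assms in simp_all)

lemma dim_on_end_swap [simp]:
  "dim_row (on_first d (mono_mat d s w)) = d * d" "dim_col (on_first d (mono_mat d s w)) = d * d"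
  "dim_row (on_second d (mono_mat d s w)) = d * d" "dim_col (on_second d (mono_mat d s w)) = d * d"
  by (simp_all add: on_first_def on_second_def kron_def)

lemma R_mat_Z_first:
  assumes "1 \<le> n" "d = dimV T n"
  shows "on_first d (Zr_mat d) * R_mat T n \<eta> u * on_first d (Zr_mat d)
    = on_second d (transpose_mat (Y_mat d u)) * R_mat T n \<eta> u * on_second d (transpose_mat (Y_mat d u))"
proof -
  have d: "2 \<le> d"
    using dimV_ge_2 assms by simp
  have car: "R_mat T n \<eta> u \<in> carrier_mat (d * d) (d * d)"
    using R_mat_carrier assms by simp
  show ?thesis
    unfolding Zr_mat_eq_mono_mat[OF d] transpose_Y_mat_eq_mono_mat[OF d]
  proof (rule pair_index_eq_matI[where d = d], goal_cases)
    case (5 i k j l)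
    \<comment> \<open>Swapping all four indices here leaves exactly the second factor swapped;
      dividing by the weight of \<open>l\<close> is multiplying by that of its swap.\<close>
    have "R_entry T n \<eta> u (end_swap d i) k (end_swap d j) l
      = end_weight d u k * R_entry T n \<eta> u i (end_swap d k) j (end_swap d l) * end_weight d u (end_swap d l)"
      using R_entry_end_swap[OF assms, of "end_swap d i" k "end_swap d j" l \<eta> u] 5
        end_weight_swap[OF d, of u l]
      by (simp add: end_swap_less end_swap_involution)
    then show ?case
      using 5 by (simp add: index_on_first_sandwich[OF car] index_on_second_sandwich[OF car]
        index_R_mat[OF assms(2)] end_swap_less del: index_mult_mat)
  qed simp_all
qed

lemma R_mat_Z_second:
  assumes "1 \<le> n" "d = dimV T n"
  shows "on_second d (Zr_mat d) * R_mat T n \<eta> u * on_second d (Zr_mat d)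
    = on_first d (Y_mat d u) * R_mat T n \<eta> u * on_first d (Y_mat d u)"
proof -
  have d: "2 \<le> d"
    using dimV_ge_2 assms by simp
  have car: "R_mat T n \<eta> u \<in> carrier_mat (d * d) (d * d)"
    using R_mat_carrier assms by simp
  show ?thesis
    unfolding Zr_mat_eq_mono_mat[OF d] Y_mat_eq_mono_mat[OF d]
  proof (rule pair_index_eq_matI[where d = d], goal_cases)
    case (5 i k j l)
    have "R_entry T n \<eta> u i (end_swap d k) j (end_swap d l)
      = end_weight d (- u) i * R_entry T n \<eta> u (end_swap d i) k (end_swap d j) l * end_weight d (- u) (end_swap d j)"
      using R_entry_end_swap'[OF assms, of i "end_swap d k" j "end_swap d l" \<eta> u] 5
      by (simp add: end_swap_less end_swap_involution end_weight_uminus[OF d] end_weight_swap[OF d])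
    then show ?case
      using 5 by (simp add: index_on_first_sandwich[OF car] index_on_second_sandwich[OF car]
        index_R_mat[OF assms(2)] end_swap_less del: index_mult_mat)
  qed simp_all
qed

section \<open>Invariance of the K-matrices\<close>

text \<open>Conjugation fixes interior diagonal entries and exchanges the end entries with factors
  \<open>exp (2 * u)\<close> and \<open>exp (- 2 * u)\<close>, so one relation between the ends
  settles both.\<close>

lemma diagonal_end_swap_invariant:
  assumes "2 \<le> d" "A \<in> carrier_mat d d" "\<And>i j. i < d \<Longrightarrow> j < d \<Longrightarrow> i \<noteq> j \<Longrightarrow> A $$ (i, j) = 0"
    and "A $$ (0, 0) = exp (2 * u) * A $$ (d - 1, d - 1)"
  shows "mono_mat d (end_swap d) (end_weight d u) * A * mono_mat d (end_swap d) (end_weight d (- u)) = A"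
proof (rule eq_matI, goal_cases)
  case (1 i j)
  then have ij: "i < d" "j < d"
    using assms(2) by auto
  have "exp (2 * u) = exp u * exp u"
    by (simp flip: exp_add)
  have "end_weight d u i * A $$ (end_swap d i, end_swap d j) * end_weight d (- u) (end_swap d j) = A $$ (i, j)"
  proof (cases "i = j")
    case True
    consider "i = 0" | "i = d - 1" | "0 < i" "i < d - 1"
      using ij by linarith
    then show ?thesis
      using assms(1,4) \<open>exp (2 * u) = exp u * exp u\<close> unfolding True[symmetric]
      by cases (simp_all add: end_swap_def end_weight_def exp_minus)
  next
    case False
    then show ?thesis
      using ij by (simp add: assms(3) end_swap_less)
  qed
  then show ?case
    using ij assms(2) by (simp add: index_mono_mat_sandwich end_swap_less end_swap_involution del: index_mult_mat)
qed (use assms in auto)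

lemma dimV_ge_double: "2 * n \<le> dimV T n"
  by (cases T) auto

lemma KR_mat_corners:
  assumes "d = dimV T n" "1 \<le> p" "p \<le> n"
  shows "KR_mat T n \<eta> \<gamma>\<^sub>0 u p $$ (0, 0) = exp (- u)" "KR_mat T n \<eta> \<gamma>\<^sub>0 u p $$ (d - 1, d - 1) = exp u"
proof -
  have "2 * n \<le> d"
    using assms(1) dimV_ge_double by simp
  then have "0 < p" "0 < d" "d - 1 < d" "\<not> d - 1 < p" "\<not> d - 1 < d - p"
    using assms(2,3) by linarith+
  then show "KR_mat T n \<eta> \<gamma>\<^sub>0 u p $$ (0, 0) = exp (- u)" "KR_mat T n \<eta> \<gamma>\<^sub>0 u p $$ (d - 1, d - 1) = exp u"
    by (simp_all add: KR_mat_def Let_def flip: assms(1))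
qed

text \<open>Only the corners are moved, so the identity also holds at the zeros of \<gamma> + exp u,
  where the middle entries have their default value.\<close>

lemma KR_mat_Y_invariant:
  assumes "d = dimV T n" "1 \<le> p" "p \<le> n"
  shows "Y_mat d u * KR_mat T n \<eta> \<gamma>\<^sub>0 u p * transpose_mat (Y_mat d u) = KR_mat T n \<eta> \<gamma>\<^sub>0 u p"
proof -
  have bounds: "1 \<le> n" "2 * n \<le> d"
    using assms dimV_ge_double by simp_all
  then have d: "2 \<le> d"
    by linarith
  \<comment> \<open>Here \<open>Y_mat\<close> stands on the left, so the diagonal criterion is used
    at \<open>- u\<close>; \<open>- (- u)\<close> keeps its shape.\<close>
  have "mono_mat d (end_swap d) (end_weight d (- u)) * KR_mat T n \<eta> \<gamma>\<^sub>0 u p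
      * mono_mat d (end_swap d) (end_weight d (- (- u))) = KR_mat T n \<eta> \<gamma>\<^sub>0 u p"
  proof (rule diagonal_end_swap_invariant)
    show "KR_mat T n \<eta> \<gamma>\<^sub>0 u p $$ (0, 0) = exp (2 * - u) * KR_mat T n \<eta> \<gamma>\<^sub>0 u p $$ (d - 1, d - 1)"
      using KR_mat_corners[OF assms] by (simp flip: exp_add)
  qed (use assms bounds in \<open>simp_all add: KR_mat_def Let_def\<close>)
  then show ?thesis
    \<comment> \<open>The transpose is rewritten first, while \<open>Y_mat\<close> is still visible
      inside it.\<close>
    unfolding transpose_Y_mat_eq_mono_mat[OF d] unfolding Y_mat_eq_mono_mat[OF d] by simp
qed

lemma index_KL_mat:
  assumes "d = dimV T n" "i < d" "j < d"
  shows "KL_mat T n \<eta> \<gamma>\<^sub>0 u p $$ (i, j)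
    = (if i = j then KR_mat T n \<eta> \<gamma>\<^sub>0 (- u - rho T n \<eta>) p $$ (i, i) * M_mat T n \<eta> $$ (i, i) else 0)"
proof -
  let ?K = "KR_mat T n \<eta> \<gamma>\<^sub>0 (- u - rho T n \<eta>) p"
  have "KL_mat T n \<eta> \<gamma>\<^sub>0 u p $$ (i, j) = (\<Sum>m<d. ?K $$ (i, m) * M_mat T n \<eta> $$ (m, j))"
    using assms by (simp add: KL_mat_def KR_mat_def M_mat_def Let_def scalar_prod_def atLeast0LessThan)
  also have "\<dots> = (\<Sum>m<d. if m = i then ?K $$ (i, i) * M_mat T n \<eta> $$ (i, j) else 0)"
    using assms by (intro sum.cong) (auto simp: KR_mat_def Let_def)
  finally show ?thesis
    using assms by (auto simp: M_mat_def Let_def)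
qed

text \<open>The extra summand of \<open>rho\<close> for \<open>A_odd2\<close> doubles to a period of
  \<open>exp\<close>, so all types give the same value.\<close>

lemma exp_two_rho: "exp (2 * rho T n \<eta>) = exp (- (4 * kap T n * \<eta>))"
proof (cases T)
  case A_odd2
  then have "2 * rho T n \<eta> = - (4 * kap T n * \<eta>) - 2 * of_real pi * \<i>"
    by (simp add: rho_def algebra_simps)
  then show ?thesis
    by (simp only: exp_diff exp_two_pi_i div_by_1)
qed (simp_all add: rho_def mult.assoc del: kap.simps)

text \<open>The sign in \<open>M_mat\<close> is common to both ends, and the exponents differ by
  four times \<open>kap T n * \<eta>\<close>.\<close>

lemma M_mat_ends:
  assumes "1 \<le> n" "d = dimV T n"
  shows "M_mat T n \<eta> $$ (d - 1, d - 1) = exp (2 * rho T n \<eta>) * M_mat T n \<eta> $$ (0, 0)"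
proof -
  have d: "0 < d" "d - 1 < d" "d - 1 + 1 = d"
    using dimV_ge_2[OF assms(1), of T] assms(2) by simp_all
  have "4 * ((of_nat d + 1) / 2 - bar_idx T n d) * \<eta>
      = - (4 * kap T n * \<eta>) + 4 * ((of_nat d + 1) / 2 - bar_idx T n 1) * \<eta>"
    using bar_idx_ends[OF assms(1), of T, folded assms(2)] by (simp add: field_simps)
  then have "exp (4 * ((of_nat d + 1) / 2 - bar_idx T n d) * \<eta>)
      = exp (2 * rho T n \<eta>) * exp (4 * ((of_nat d + 1) / 2 - bar_idx T n 1) * \<eta>)"
    by (simp only: exp_add exp_two_rho)
  then show ?thesis
    using d by (simp add: M_mat_def Let_def flip: assms(2))
qed

lemma KL_mat_Y_invariant:
  assumes "d = dimV T n" "1 \<le> p" "p \<le> n"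
  shows "transpose_mat (Y_mat d u) * KL_mat T n \<eta> \<gamma>\<^sub>0 u p * Y_mat d u = KL_mat T n \<eta> \<gamma>\<^sub>0 u p"
proof -
  have bounds: "1 \<le> n" "2 * n \<le> d"
    using assms dimV_ge_double by simp_all
  then have d: "2 \<le> d"
    by linarith
  have "mono_mat d (end_swap d) (end_weight d u) * KL_mat T n \<eta> \<gamma>\<^sub>0 u p
      * mono_mat d (end_swap d) (end_weight d (- u)) = KL_mat T n \<eta> \<gamma>\<^sub>0 u p"
  proof (rule diagonal_end_swap_invariant)
    let ?v = "- u - rho T n \<eta>"
    \<comment> \<open>The corner ratio \<open>exp (- 2 * ?v)\<close>; its part in \<open>rho\<close>
      cancels against the ratio of the ends of \<open>M_mat\<close>.\<close>
    have "KR_mat T n \<eta> \<gamma>\<^sub>0 ?v p $$ (0, 0) = exp (2 * u + 2 * rho T n \<eta>) * KR_mat T n \<eta> \<gamma>\<^sub>0 ?v p $$ (d - 1, d - 1)"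
      using KR_mat_corners[OF assms] by (simp add: add.commute flip: exp_add)
    then show "KL_mat T n \<eta> \<gamma>\<^sub>0 u p $$ (0, 0) = exp (2 * u) * KL_mat T n \<eta> \<gamma>\<^sub>0 u p $$ (d - 1, d - 1)"
      using bounds M_mat_ends[OF bounds(1) assms(1), of \<eta>]
      by (simp add: index_KL_mat[OF assms(1)] exp_add)
    show "KL_mat T n \<eta> \<gamma>\<^sub>0 u p \<in> carrier_mat d d"
      by (auto simp: KL_mat_def KR_mat_def M_mat_def Let_def assms(1))
  qed (use bounds in \<open>simp_all add: index_KL_mat[OF assms(1)]\<close>)
  then show ?thesis
    unfolding transpose_Y_mat_eq_mono_mat[OF d] unfolding Y_mat_eq_mono_mat[OF d] by simp
qed

theorem lemma9:
  fixes T :: affine_type and n d :: nat and \<eta> :: complex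
  assumes "n \<ge> 1" and "d = dimV T n"
  shows "(\<forall>u. on_first d (Zr_mat d) * R_mat T n \<eta> u * on_first d (Zr_mat d)
            = on_second d (transpose_mat (Y_mat d u)) * R_mat T n \<eta> u
                * on_second d (transpose_mat (Y_mat d u)))
    \<and> (\<forall>u. on_second d (Zr_mat d) * R_mat T n \<eta> u * on_second d (Zr_mat d)
            = on_first d (Y_mat d u) * R_mat T n \<eta> u * on_first d (Y_mat d u))
    \<and> (\<forall>p \<gamma>\<^sub>0. 1 \<le> p \<and> p \<le> n \<and> \<gamma>\<^sub>0 \<in> {1, - 1} \<longrightarrow>
          (\<forall>u. Y_mat d u * KR_mat T n \<eta> \<gamma>\<^sub>0 u p * transpose_mat (Y_mat d u) = KR_mat T n \<eta> \<gamma>\<^sub>0 u p)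
        \<and> (\<forall>u. transpose_mat (Y_mat d u) * KL_mat T n \<eta> \<gamma>\<^sub>0 u p * Y_mat d u = KL_mat T n \<eta> \<gamma>\<^sub>0 u p))"
  using R_mat_Z_first[OF assms] R_mat_Z_second[OF assms]
    KR_mat_Y_invariant[OF assms(2)] KL_mat_Y_invariant[OF assms(2)] by blast

end
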